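(* Let $\alpha>0$, $\rho>0$, $q\in[0,1]$, let $\mathcal G$ be a finite collection of groups $g:\mathcal X\to\{0,1\}$ and $f:\mathcal X\to[0,1]$ a model. Suppose $\mathcal S$ is $\rho$-Lipschitz and continuous, and $m=\frac{8\rho^2}{\alpha}$. After $T\le\frac{32\rho^3}{\alpha^2}$ many rounds, the algorithm BatchMVP$(f,\alpha,q,\mathcal G,\rho,\mathcal S,m)$ (described in the context) returns $f_T$ such that: 1. $PB^{\mathcal S}_q(f_T)\le PB^{\mathcal S}_q(f_0)-T\,\frac{\alpha^2}{32\rho^3}$, where $f_0$ is the algorithm's initial (rounded) model. 2. $f_T$ is $\alpha$-approximately $q$-quantile multicalibrated with respect to $\mathcal G$ on $\mathcal S$. In particular, for every $g\in\mathcal G$ and $v\in R(f_T)$ (with $\Pr_{(x,s)\sim\mathcal S}[g(x)=1,f_T(x)=v]>0$), $$\Big|\Pr_{(x,s)\sim\mathcal S}\big[s\le f_T(x)\mid g(x)=1,f_T(x)=v\big]-q\Big|\le\frac{\sqrt\alpha}{\sqrt{\Pr_{(x,s)\sim\mathcal S}[g(x)=1,f_T(x)=v]}}.$$ In other words, for every such $g$ and $v$, $$\Big|\Pr_{(x,y)\sim\mathcal D}\big[y\in\mathcal T^{f_T}(x)\mid g(x)=1,f_T(x)=v\big]-q\Big|\le\frac{\sqrt\alpha}{\sqrt{\Pr_{(x,s)\sim\mathcal S}[g(x)=1,f_T(x)=v]}},$$ where $\mathcal T^{f_T}(x)=\{y: s(x,y)\le f_T(x)\}$.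
   Context: Setting. $\mathcal D$ is a probability distribution on $\mathcal X\times\mathcal Y$, and $s:\mathcal X\times\mathcal Y\to[0,1]$ is a nonconformity score. $\mathcal S$ denotes the induced joint distribution of $(x,s(x,y))$ on $\mathcal X\times[0,1]$, and $\mathcal S(x)$ the conditional distribution of the score given $x$. "$\mathcal S$ is continuous" means every $\mathcal S(x)$ is a continuous distribution. $\mathcal S$ is $\rho$-Lipschitz if for every $x\in\mathcal X$ and all $0\le\tau\le\tau'\le1$: $\Pr_{s\sim\mathcal S(x)}[s\le\tau']-\Pr_{s\sim\mathcal S(x)}[s\le\tau]\le\rho(\tau'-\tau)$. $R(f)=\{f(x):x\in\mathcal X\}$ is the range of $f$. Pinball loss: $L_q(\tau,s)=(s-\tau)q\,\mathbf 1[s>\tau]+(\tau-s)(1-q)\,\mathbf 1[s\le\tau]$, and $PB^{\mathcal S}_q(f)=\mathbb E_{(x,s)\sim\mathcal S}[L_q(f(x),s)]$. Quantile multicalibration on a distribution $P$ over $\mathcal X\times[0,1]$: for a predictor $f:\mathcal X\to[0,1]$ of finite range and a group $g$, $$Q(f,g)=\sum_{v\in R(f)}\Pr_{(x,s)\sim P}[f(x)=v\mid g(x)=1]\Big(q-\Pr_{(x,s)\sim P}[s\le f(x)\mid f(x)=v,g(x)=1]\Big)^2,$$ with terms of zero probability counted as $0$. $f$ is $\alpha$-approximately $q$-quantile multicalibrated with respect to $\mathcal G$ on $P$ if $Q(f,g)\le\alpha/\Pr_{(x,s)\sim P}[g(x)=1]$ for every $g\in\mathcal G$ (groups of zero probability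 impose no condition). Algorithm BatchMVP$(f,\alpha,q,\mathcal G,\rho,P,m)$. Write $[\tfrac1m]=\{0,\tfrac1m,\dots,\tfrac{m-1}m,1\}$. Initialize $t=0$ and $f_0(x)\in\arg\min_{v\in[\frac1m]}|v-f(x)|$ for $x\in\mathcal X$. While $f_t$ is not $\alpha$-approximately $q$-quantile multicalibrated with respect to $\mathcal G$ (on $P$): choose $$(v_t,g_t)\in\arg\max_{(v,g)\in[\frac1m]\times\mathcal G}\Pr_{(x,s)\sim P}[f_t(x)=v,g(x)=1]\big(q-\Pr_{(x,s)\sim P}[s\le f_t(x)\mid f_t(x)=v,g(x)=1]\big)^2,$$ let $B_t=\{x:f_t(x)=v_t,g_t(x)=1\}$; let $$\Delta_t=\arg\min_{\Delta\in[\frac1m]}\big|\Pr_{(x,s)\sim P}[s\le f_t(x)+\Delta\mid x\in B_t]-q\big|;$$ set $f_{t+1}(x)=f_t(x)+\Delta_t$ for $x\in B_t$ and $f_{t+1}(x)=f_t(x)$ otherwise; increment $t$. Output $f_t$. The number of rounds is the number of executions of the loop body.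
   Formalization: The choice of Δ_t is corrected: Δ ranges over signed shifts with v_t+Δ in [1/m] (with Δ ≥ 0 only, an over-covering model is never lowered and the loop may not end), and among tied minimisers the one of least |Δ| is taken (other ties can raise the pinball loss). *)

theory Defs
  imports "HOL-Probability.Probability"
begin

(* X is the measurable space MX and Y the measurable space MY, so the set X itself is space MX.
   Distributions over X * [0,1] are measures P on pairs whose second component is the score;
   "\<P>(_ in P. _)" and "\<P>(_ in P. _ \<bar> _)" are the library's probability and conditional
   probability, the latter being 0 when the conditioning event has probability 0. *)

definition score_distribution ::
  "'x measure \<Rightarrow> ('x \<times> 'y) measure \<Rightarrow> ('x \<Rightarrow> 'y \<Rightarrow> real) \<Rightarrow> ('x \<times> real) measure" where
  "score_distribution MX D s = distr D (MX \<Otimes>\<^sub>M borel) (\<lambda>(x, y). (x, s x y))"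

(* K is a (regular) conditional distribution, given x, of the [0,1]-valued score under P:
   a Markov kernel that disintegrates P over its X-marginal. *)
definition conditional_score_distribution ::
  "'x measure \<Rightarrow> ('x \<times> real) measure \<Rightarrow> ('x \<Rightarrow> real measure) \<Rightarrow> bool" where
  "conditional_score_distribution MX P K \<longleftrightarrow>
     K \<in> MX \<rightarrow>\<^sub>M prob_algebra borel \<and>
     (\<forall>x\<in>space MX. measure (K x) {0..1} = 1) \<and>
     (\<forall>A\<in>sets MX. \<forall>B\<in>sets borel.
        emeasure P (A \<times> B) = (\<integral>\<^sup>+x\<in>A. emeasure (K x) B \<partial>distr P MX fst))"

definition continuous_scores :: "'x measure \<Rightarrow> ('x \<Rightarrow> real measure) \<Rightarrow> bool" where
  "continuous_scores MX K \<longleftrightarrow> (\<forall>x\<in>space MX. continuous_on UNIV (cdf (K x)))"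

definition lipschitz_scores :: "real \<Rightarrow> 'x measure \<Rightarrow> ('x \<Rightarrow> real measure) \<Rightarrow> bool" where
  "lipschitz_scores \<rho> MX K \<longleftrightarrow>
     (\<forall>x\<in>space MX. \<forall>\<tau> \<tau>'. 0 \<le> \<tau> \<and> \<tau> \<le> \<tau>' \<and> \<tau>' \<le> 1 \<longrightarrow>
        cdf (K x) \<tau>' - cdf (K x) \<tau> \<le> \<rho> * (\<tau>' - \<tau>))"

definition pinball_loss :: "real \<Rightarrow> real \<Rightarrow> real \<Rightarrow> real" where
  "pinball_loss q \<tau> r = (r - \<tau>) * q * of_bool (r > \<tau>) + (\<tau> - r) * (1 - q) * of_bool (r \<le> \<tau>)"

definition PB :: "real \<Rightarrow> ('x \<times> real) measure \<Rightarrow> ('x \<Rightarrow> real) \<Rightarrow> real" where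
  "PB q P f = (\<integral>(x, r). pinball_loss q (f x) r \<partial>P)"

definition calibration_error ::
  "'x measure \<Rightarrow> ('x \<times> real) measure \<Rightarrow> real \<Rightarrow> ('x \<Rightarrow> real) \<Rightarrow> ('x \<Rightarrow> nat) \<Rightarrow> real" where
  "calibration_error MX P q f g =
     (\<Sum>v\<in>f ` space MX. \<P>((x, r) in P. f x = v \<bar> g x = 1) *
        (q - \<P>((x, r) in P. r \<le> f x \<bar> f x = v \<and> g x = 1))\<^sup>2)"

(* The notion is defined for finite-range predictors into [0,1]; the first two conjuncts say so. *)
definition quantile_multicalibrated ::
  "'x measure \<Rightarrow> ('x \<times> real) measure \<Rightarrow> real \<Rightarrow> real \<Rightarrow> ('x \<Rightarrow> nat) set \<Rightarrow> ('x \<Rightarrow> real) \<Rightarrow> bool" where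
  "quantile_multicalibrated MX P \<alpha> q G f \<longleftrightarrow>
     finite (f ` space MX) \<and> f ` space MX \<subseteq> {0..1} \<and>
     (\<forall>g\<in>G. \<P>((x, r) in P. g x = 1) > 0 \<longrightarrow>
        calibration_error MX P q f g \<le> \<alpha> / \<P>((x, r) in P. g x = 1))"

definition unit_grid :: "nat \<Rightarrow> real set" where
  "unit_grid m = (\<lambda>i. real i / real m) ` {0..m}"

definition weighted_bias ::
  "('x \<times> real) measure \<Rightarrow> real \<Rightarrow> ('x \<Rightarrow> real) \<Rightarrow> real \<Rightarrow> ('x \<Rightarrow> nat) \<Rightarrow> real" where
  "weighted_bias P q f v g = \<P>((x, r) in P. f x = v \<and> g x = 1) *
     (q - \<P>((x, r) in P. r \<le> f x \<bar> f x = v \<and> g x = 1))\<^sup>2"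

(* The admissible shifts of the value v on the set B are those that lead from v to a grid point
   (they may be negative); the shift chosen minimises the deviation of the coverage from q.
   Where the coverage is flat there can be several minimisers, and then the one of least absolute
   value is meant: far-away minimisers can increase the pinball loss. *)
definition coverage_shift ::
  "('x \<times> real) measure \<Rightarrow> real \<Rightarrow> nat \<Rightarrow> ('x \<Rightarrow> real) \<Rightarrow> real \<Rightarrow> 'x set \<Rightarrow> real \<Rightarrow> bool" where
  "coverage_shift P q m f v B =
     is_arg_min (\<lambda>\<Delta>. \<bar>\<Delta>\<bar>)
       (is_arg_min (\<lambda>\<Delta>. \<bar>\<P>((x, r) in P. r \<le> f x + \<Delta> \<bar> x \<in> B) - q\<bar>)
          (\<lambda>\<Delta>. v + \<Delta> \<in> unit_grid m))"

(* One execution of the loop body, turning f into f'. *)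
definition batch_mvp_step ::
  "'x measure \<Rightarrow> ('x \<times> real) measure \<Rightarrow> real \<Rightarrow> ('x \<Rightarrow> nat) set \<Rightarrow> nat \<Rightarrow>
   ('x \<Rightarrow> real) \<Rightarrow> ('x \<Rightarrow> real) \<Rightarrow> bool" where
  "batch_mvp_step MX P q G m f f' \<longleftrightarrow>
     (\<exists>v g \<Delta> B.
        is_arg_max (\<lambda>(v, g). weighted_bias P q f v g) (\<lambda>(v, g). v \<in> unit_grid m \<and> g \<in> G) (v, g) \<and>
        B = {x \<in> space MX. f x = v \<and> g x = 1} \<and>
        coverage_shift P q m f v B \<Delta> \<and>
        f' = (\<lambda>x. if x \<in> B then f x + \<Delta> else f x))"

(* F 0, F 1, ... are the models of an execution; the sequence stays constant once the loop has
   been left.  The initial rounding and (v, g) may be chosen freely among the optima.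
   The Lipschitz parameter of the input is not used by the algorithm. *)
definition batch_mvp_run ::
  "'x measure \<Rightarrow> ('x \<Rightarrow> real) \<Rightarrow> real \<Rightarrow> real \<Rightarrow> ('x \<Rightarrow> nat) set \<Rightarrow> ('x \<times> real) measure \<Rightarrow> nat \<Rightarrow>
   (nat \<Rightarrow> 'x \<Rightarrow> real) \<Rightarrow> bool" where
  "batch_mvp_run MX f \<alpha> q G P m F \<longleftrightarrow>
     F 0 \<in> borel_measurable MX \<and>
     (\<forall>x\<in>space MX. is_arg_min (\<lambda>v. \<bar>v - f x\<bar>) (\<lambda>v. v \<in> unit_grid m) (F 0 x)) \<and>
     (\<forall>t. if quantile_multicalibrated MX P \<alpha> q G (F t) then F (Suc t) = F t
          else batch_mvp_step MX P q G m (F t) (F (Suc t)))"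

(* The execution F leaves the loop after exactly T rounds, returning F T. *)
definition batch_mvp_returns_after ::
  "'x measure \<Rightarrow> real \<Rightarrow> real \<Rightarrow> ('x \<Rightarrow> nat) set \<Rightarrow> ('x \<times> real) measure \<Rightarrow>
   (nat \<Rightarrow> 'x \<Rightarrow> real) \<Rightarrow> nat \<Rightarrow> bool" where
  "batch_mvp_returns_after MX \<alpha> q G P F T \<longleftrightarrow>
     quantile_multicalibrated MX P \<alpha> q G (F T) \<and>
     (\<forall>t<T. \<not> quantile_multicalibrated MX P \<alpha> q G (F t))"

definition prediction_set ::
  "'y measure \<Rightarrow> ('x \<Rightarrow> 'y \<Rightarrow> real) \<Rightarrow> ('x \<Rightarrow> real) \<Rightarrow> 'x \<Rightarrow> 'y set" where
  "prediction_set MY s f x = {y \<in> space MY. s x y \<le> f x}"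

end

theory Submission
  imports Defs
begin

text \<open>
  The loss of a constant threshold \<open>\<tau>\<close> on the current set \<open>B\<close> is a convex function of \<open>\<tau>\<close> whose
  derivative is the coverage of \<open>\<tau>\<close> minus \<open>q\<close>, and this derivative is \<open>\<rho>\<close>-Lipschitz. Following it
  from the current value, where it equals \<open>d\<close>, down to a zero gains at least \<open>d\<^sup>2 / (2\<rho>)\<close>, and
  stopping at a best grid point costs at most \<open>\<rho> / m\<^sup>2\<close>. Before the loop stops, some value and
  group satisfy \<open>Pr[B] d\<^sup>2 > \<alpha> / (m + 1)\<close> by pigeonhole over the \<open>m + 1\<close> grid points. Since
  \<open>\<rho> \<ge> 1\<close>, this also forces \<open>m \<ge> 3\<close>, and then the net gain per round is at least
  \<open>\<alpha>\<^sup>2 / (32\<rho>\<^sup>3)\<close>. The loss stays in \<open>[0, 1]\<close>, which bounds the number of rounds.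
\<close>

section \<open>Pinball loss\<close>

text \<open>The loss is convex in the threshold, with slope \<open>- q\<close> while the score lies
  above it and \<open>1 - q\<close> afterwards. So \<open>of_bool (r \<le> b) - q\<close> is a
  subgradient at \<open>b\<close>, whose average over scores is coverage minus
  \<open>q\<close>.\<close>

lemma pinball_subgradient:
  "pinball_loss q b r - pinball_loss q a r \<le> (of_bool (r \<le> b) - q) * (b - a)"
  by (cases "r \<le> b"; cases "r \<le> a") (auto simp: pinball_loss_def algebra_simps)

lemma pinball_nonneg: "q \<in> {0..1} \<Longrightarrow> 0 \<le> pinball_loss q \<tau> r"
  by (auto simp: pinball_loss_def)

lemma pinball_le:
  assumes "q \<in> {0..1}"
  shows "pinball_loss q \<tau> r \<le> \<bar>\<tau> - r\<bar>"
  using assms mult_left_le[of q "r - \<tau>"] mult_left_le[of "1 - q" "\<tau> - r"]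
  by (cases "r \<le> \<tau>") (auto simp: pinball_loss_def)

lemma borel_measurable_pinball [measurable]:
  assumes [measurable]: "f \<in> borel_measurable M" "g \<in> borel_measurable M"
  shows "(\<lambda>z. pinball_loss q (f z) (g z)) \<in> borel_measurable M"
  unfolding pinball_loss_def by measurable

section \<open>Descent to a grid minimiser\<close>

text \<open>A convex function with a continuous selection \<open>h\<close> of subgradients is
  differentiable with derivative \<open>h\<close>. The Lipschitz bound on \<open>h\<close> then
  gives the usual quadratic upper model around \<open>a\<close>.\<close>

lemma Lipschitz_subgradient_descent:
  fixes h \<Phi> :: "real \<Rightarrow> real"
  assumes lip: "\<And>a b. a \<le> b \<Longrightarrow> h b - h a \<le> \<rho> * (b - a)"
    and sub: "\<And>a b. \<Phi> b - \<Phi> a \<le> h b * (b - a)"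
    and "a \<le> b"
  shows "\<Phi> b \<le> \<Phi> a + h a * (b - a) + \<rho> * (b - a)\<^sup>2 / 2"
proof -
  \<comment> \<open>The subgradient inequalities for \<open>(x, y)\<close> and \<open>(y, x)\<close>
    add up to monotonicity, which makes the one-sided Lipschitz bound two-sided.\<close>
  have mono: "h x \<le> h y" if "x \<le> y" for x y
  proof (cases "x = y")
    case False
    have "0 \<le> (h y - h x) * (y - x)"
      using sub[of y x] sub[of x y] by (simp add: algebra_simps)
    with False that show ?thesis by (simp add: zero_le_mult_iff)
  qed simp
  have abs_lip: "\<bar>h y - h x\<bar> \<le> \<rho> * \<bar>y - x\<bar>" for x y
    using lip[of x y] lip[of y x] mono[of x y] mono[of y x] by (cases "x \<le> y") auto
  \<comment> \<open>The difference quotient between \<open>x\<close> and \<open>y\<close> lies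
    between \<open>h x\<close> and \<open>h y\<close>, so its error is at most
    \<open>\<bar>h y - h x\<bar>\<close>, which vanishes by continuity.\<close>
  have deriv: "(\<Phi> has_real_derivative h x) (at x)" for x
  proof -
    have cont: "isCont h x"
    proof -
      have "((\<lambda>y. \<rho> * \<bar>y - x\<bar>) \<longlongrightarrow> 0) (at x)"
        by (auto intro!: tendsto_eq_intros)
      then have "((\<lambda>y. h y - h x) \<longlongrightarrow> 0) (at x)"
        by (rule Lim_null_comparison[rotated]) (simp add: abs_lip)
      then show ?thesis unfolding isCont_def by (simp add: LIM_zero_iff)
    qed
    have "((\<lambda>y. (\<Phi> y - \<Phi> x) / (y - x) - h x) \<longlongrightarrow> 0) (at x)"
    proof (rule Lim_null_comparison[where g="\<lambda>y. \<bar>h y - h x\<bar>"])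
      show "\<forall>\<^sub>F y in at x. norm ((\<Phi> y - \<Phi> x) / (y - x) - h x) \<le> \<bar>h y - h x\<bar>"
        unfolding eventually_at_filter
      proof (intro always_eventually allI impI)
        fix y assume "y \<noteq> x"
        have "(\<Phi> y - \<Phi> x - h x * (y - x)) \<ge> 0"
          using sub[of x y] by (simp add: algebra_simps)
        moreover have "\<Phi> y - \<Phi> x - h x * (y - x) \<le> (h y - h x) * (y - x)"
          using sub[of y x] by (simp add: algebra_simps)
        ultimately have "\<bar>\<Phi> y - \<Phi> x - h x * (y - x)\<bar> \<le> \<bar>h y - h x\<bar> * \<bar>y - x\<bar>"
          unfolding abs_mult[symmetric] by linarith
        moreover have "(\<Phi> y - \<Phi> x) / (y - x) - h x = (\<Phi> y - \<Phi> x - h x * (y - x)) / (y - x)"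
          using \<open>y \<noteq> x\<close> by (simp add: field_simps)
        ultimately show "norm ((\<Phi> y - \<Phi> x) / (y - x) - h x) \<le> \<bar>h y - h x\<bar>"
          using \<open>y \<noteq> x\<close> by (simp add: abs_divide pos_divide_le_eq)
      qed
      show "((\<lambda>y. \<bar>h y - h x\<bar>) \<longlongrightarrow> 0) (at x)"
        using cont by (intro tendsto_rabs_zero) (simp add: isCont_def LIM_zero)
    qed
    then show ?thesis
      unfolding has_field_derivative_iff by (rule LIM_zero_cancel)
  qed
  \<comment> \<open>Apart from the constant \<open>\<Phi> a\<close>, this is \<Phi> minus its
    quadratic upper model; its derivative is nonpositive to the right of \<open>a\<close>.\<close>
  define \<Psi> where "\<Psi> x = \<Phi> x - h a * (x - a) - \<rho> * (x - a)\<^sup>2 / 2" for x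
  have "\<Psi> b \<le> \<Psi> a"
  proof (rule DERIV_nonpos_imp_nonincreasing[OF \<open>a \<le> b\<close>])
    fix x assume x: "a \<le> x" "x \<le> b"
    have "(\<Psi> has_real_derivative h x - h a - \<rho> * (x - a)) (at x)"
      unfolding \<Psi>_def by (auto intro!: derivative_eq_intros deriv)
    moreover have "h x - h a - \<rho> * (x - a) \<le> 0" using lip[of a x] x by auto
    ultimately show "\<exists>y. (\<Psi> has_real_derivative y) (at x) \<and> y \<le> 0" by blast
  qed
  then show ?thesis by (simp add: \<Psi>_def)
qed

section \<open>The grid of thresholds\<close>

lemma unit_grid_bounds: "v \<in> unit_grid m \<Longrightarrow> 0 \<le> v \<and> v \<le> 1"
  by (auto simp: unit_grid_def divide_le_eq)

lemma finite_unit_grid [simp]: "finite (unit_grid m)"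
  by (simp add: unit_grid_def)

lemma card_unit_grid_le: "card (unit_grid m) \<le> m + 1"
  unfolding unit_grid_def by (rule order_trans[OF card_image_le]) auto

lemma unit_grid_reflect:
  assumes "v \<in> unit_grid m" and "m > 0"
  shows "1 - v \<in> unit_grid m"
proof -
  obtain i where "i \<le> m" "v = real i / real m" using assms by (auto simp: unit_grid_def)
  then have "1 - v = real (m - i) / real m" using assms by (simp add: field_simps of_nat_diff)
  then show ?thesis by (auto simp: unit_grid_def)
qed

text \<open>
  \<open>w\<close> is where the slowest possible increase of \<open>h\<close> would reach 0 and \<open>z\<close> is an actual zero. The
  loss at \<open>v'\<close> is compared with the loss at \<open>w\<close>, going through \<open>z\<close> when \<open>v'\<close> overshoots; the
  tie-breaking rule keeps \<open>v'\<close> from overshooting by more than one grid cell.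
\<close>
lemma grid_minimizer_descent_up:
  fixes h \<Phi> :: "real \<Rightarrow> real"
  assumes mono: "\<And>a b. a \<le> b \<Longrightarrow> h a \<le> h b"
    and lip: "\<And>a b. a \<le> b \<Longrightarrow> h b - h a \<le> \<rho> * (b - a)"
    and sub: "\<And>a b. \<Phi> b - \<Phi> a \<le> h b * (b - a)"
    and "\<rho> > 0" and "m > 0" and "h 1 \<ge> 0"
    and v: "v \<in> unit_grid m" and v': "v' \<in> unit_grid m"
    and opt: "\<And>w. w \<in> unit_grid m \<Longrightarrow> \<bar>h v'\<bar> \<le> \<bar>h w\<bar>"
    and tie: "\<And>w. w \<in> unit_grid m \<Longrightarrow> \<bar>h w\<bar> = \<bar>h v'\<bar> \<Longrightarrow> \<bar>v' - v\<bar> \<le> \<bar>w - v\<bar>"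
    and neg: "h v < 0"
  shows "\<Phi> v' \<le> \<Phi> v - ((h v)\<^sup>2 / (2 * \<rho>) - \<rho> / (real m)\<^sup>2)"
proof -
  have m: "real m > 0" using \<open>m > 0\<close> by simp
  have abs_lip: "\<bar>h y - h x\<bar> \<le> \<rho> * \<bar>y - x\<bar>" for x y
    using lip[of x y] lip[of y x] mono[of x y] mono[of y x] by (cases "x \<le> y") auto
  have "v \<le> 1" "0 \<le> v" using unit_grid_bounds[OF v] by auto
  have "continuous_on {v..1} h"
    by (rule lipschitz_on_continuous_on[of \<rho>], rule lipschitz_onI)
      (use abs_lip \<open>\<rho> > 0\<close> in \<open>auto simp: dist_real_def abs_minus_commute\<close>)
  then obtain z where z: "v \<le> z" "z \<le> 1" "h z = 0"
    using IVT'[of h v 0 1] neg \<open>h 1 \<ge> 0\<close> \<open>v \<le> 1\<close> by force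
  \<comment> \<open>Since \<open>h\<close> rises at rate at most \<rho>, it cannot reach 0 before
    \<open>w\<close>; hence \<open>w \<le> z\<close>.\<close>
  define w where "w = v - h v / \<rho>"
  have "v \<le> w" using neg \<open>\<rho> > 0\<close> by (simp add: w_def field_simps)
  have "w \<le> z" using lip[of v z] z \<open>\<rho> > 0\<close> by (simp add: w_def field_simps)
  have "h w \<le> 0" using mono[of w z] \<open>w \<le> z\<close> z by simp
  \<comment> \<open>\<open>w\<close> minimises the quadratic upper model at \<open>v\<close>, and
    the minimal value is the claimed gain.\<close>
  have gain: "\<Phi> w \<le> \<Phi> v - (h v)\<^sup>2 / (2 * \<rho>)"
    using Lipschitz_subgradient_descent[of h \<rho> \<Phi> v w, OF lip sub \<open>v \<le> w\<close>] \<open>\<rho> > 0\<close>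
    by (simp add: w_def field_simps power2_eq_square)
  \<comment> \<open>\<open>u\<close> is the left end of the grid cell containing the zero
    \<open>z\<close>. Its existence shows that the best grid value of \<open>\<bar>h\<bar>\<close>
    is at most \<open>\<rho> / real m\<close>.\<close>
  define i where "i = nat \<lfloor>real m * z\<rfloor>"
  have i: "real i \<le> real m * z" "real m * z < real i + 1"
    using z \<open>0 \<le> v\<close> unfolding i_def by (auto simp: of_nat_nat)
  then have "real i \<le> real m" using z(2) m mult_left_le[of z "real m"] by linarith
  define u where "u = real i / real m"
  have u: "u \<in> unit_grid m" using \<open>real i \<le> real m\<close> by (auto simp: u_def unit_grid_def)
  have "u \<le> z" "z < u + 1 / real m" using i m by (auto simp: u_def field_simps)
  have hu: "\<bar>h u\<bar> \<le> \<rho> / real m"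
  proof -
    have "\<bar>h u\<bar> \<le> \<rho> * \<bar>u - z\<bar>" using abs_lip[of u z] z by simp
    also have "\<dots> \<le> \<rho> * (1 / real m)"
      using \<open>u \<le> z\<close> \<open>z < u + 1 / real m\<close> \<open>\<rho> > 0\<close> by (intro mult_left_mono) auto
    finally show ?thesis by simp
  qed
  have "\<Phi> v' - \<Phi> w \<le> \<rho> / (real m)\<^sup>2"
  proof (cases "v' \<le> z")
    case True
    have hv': "h v' \<le> 0" using mono[OF True] z by simp
    show ?thesis
    proof (cases "w \<le> v'")
      case True
      then have "h v' * (v' - w) \<le> 0" using hv' by (simp add: mult_nonpos_nonneg)
      then show ?thesis using sub[of v' w] \<open>\<rho> > 0\<close> by (smt (verit) divide_nonneg_nonneg zero_le_power2)
    next
      case False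
      \<comment> \<open>Moving left of \<open>v\<close> only makes \<open>h\<close> more negative,
        so such a \<open>v'\<close> could at best tie with \<open>v\<close>. The tie rule would then
        prefer \<open>v\<close>, at distance 0.\<close>
      have "v \<le> v'"
      proof (rule ccontr)
        assume less: "\<not> v \<le> v'"
        then have "\<bar>h v\<bar> = \<bar>h v'\<bar>" using mono[of v' v] neg opt[OF v] by auto
        from tie[OF v this] less show False by simp
      qed
      have le: "\<bar>h v'\<bar> \<le> \<rho> / real m" using opt[OF u] hu by simp
      have "- (\<rho> / real m) - h v \<le> \<rho> * (v' - v)" using lip[OF \<open>v \<le> v'\<close>] le by linarith
      \<comment> \<open>The deficit left at \<open>v'\<close> is at most
        \<open>\<rho> / real m\<close>, while from \<open>v\<close> on \<open>h\<close> climbs at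
        rate at most \<rho>: stopping short of \<open>w\<close> loses at most one cell.\<close>
      then have "w - v' \<le> 1 / real m" using \<open>\<rho> > 0\<close> m by (simp add: w_def field_simps)
      then have "\<bar>h v'\<bar> * (w - v') \<le> \<rho> / real m * (1 / real m)"
        using le False \<open>\<rho> > 0\<close> by (intro mult_mono) auto
      then show ?thesis using sub[of v' w] hv' by (simp add: power2_eq_square algebra_simps)
    qed
  next
    case False
    \<comment> \<open>The zero of the subgradient minimises \<Phi>.\<close>
    have "\<Phi> z \<le> \<Phi> w" using sub[of z w] z by simp
    moreover have "\<Phi> v' - \<Phi> z \<le> \<rho> / (real m)\<^sup>2"
    proof -
      obtain j where j: "j \<le> m" "v' = real j / real m" using v' by (auto simp: unit_grid_def)
      have "real i < real j"
        using \<open>u \<le> z\<close> False m unfolding u_def j by (smt (verit) divide_right_mono)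
      then have "i + 1 \<le> j" by simp
      \<comment> \<open>\<open>u'\<close> is the first grid point to the right of \<open>z\<close>.
        By monotonicity it is at least as good as \<open>v'\<close>, so the two tie and the tie rule
        forces \<open>v' \<le> u'\<close>.\<close>
      define u' where "u' = real (i + 1) / real m"
      have u': "u' \<in> unit_grid m" using \<open>i + 1 \<le> j\<close> j unfolding u'_def unit_grid_def by (intro imageI) simp
      have "u' \<le> v'" unfolding u'_def j using \<open>i + 1 \<le> j\<close> m by (intro divide_right_mono) auto
      have u'_eq: "u' = u + 1 / real m" by (simp add: u'_def u_def add_divide_distrib)
      have "z < u'" using \<open>z < u + 1 / real m\<close> u'_eq by simp
      have "\<bar>h u'\<bar> = \<bar>h v'\<bar>"
        using mono[OF \<open>u' \<le> v'\<close>] mono[of z u'] \<open>z < u'\<close> z opt[OF u'] by auto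
      from tie[OF u' this] have "v' \<le> u'" using \<open>z < u'\<close> \<open>u' \<le> v'\<close> z by auto
      then have len: "v' - z \<le> 1 / real m" using u'_eq \<open>u \<le> z\<close> by simp
      have "h v' \<le> \<rho> * (v' - z)" using lip[of z v'] False z by simp
      also have "\<dots> \<le> \<rho> * (1 / real m)" using len \<open>\<rho> > 0\<close> by (intro mult_left_mono) auto
      finally have "h v' * (v' - z) \<le> \<rho> * (1 / real m) * (1 / real m)"
        using len False \<open>\<rho> > 0\<close> by (intro mult_mono) auto
      then show ?thesis using sub[of v' z] by (simp add: power2_eq_square)
    qed
    ultimately show ?thesis by simp
  qed
  with gain show ?thesis by simp
qed

text \<open>When \<open>h v > 0\<close> the threshold has to go down. The reflection
  \<open>t \<mapsto> 1 - t\<close> preserves the grid and the distances, flips the sign of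
  \<open>h\<close> and turns \<open>h 0 \<le> 0\<close> into the condition at 1, so the upward case
  applies.\<close>

lemma grid_minimizer_descent:
  fixes h \<Phi> :: "real \<Rightarrow> real"
  assumes mono: "\<And>a b. a \<le> b \<Longrightarrow> h a \<le> h b"
    and lip: "\<And>a b. a \<le> b \<Longrightarrow> h b - h a \<le> \<rho> * (b - a)"
    and sub: "\<And>a b. \<Phi> b - \<Phi> a \<le> h b * (b - a)"
    and "\<rho> > 0" and "m > 0" and "h 0 \<le> 0" and "h 1 \<ge> 0"
    and v: "v \<in> unit_grid m" and v': "v' \<in> unit_grid m"
    and opt: "\<And>w. w \<in> unit_grid m \<Longrightarrow> \<bar>h v'\<bar> \<le> \<bar>h w\<bar>"
    and tie: "\<And>w. w \<in> unit_grid m \<Longrightarrow> \<bar>h w\<bar> = \<bar>h v'\<bar> \<Longrightarrow> \<bar>v' - v\<bar> \<le> \<bar>w - v\<bar>"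
    and "h v \<noteq> 0"
  shows "\<Phi> v' \<le> \<Phi> v - ((h v)\<^sup>2 / (2 * \<rho>) - \<rho> / (real m)\<^sup>2)"
proof (cases "h v < 0")
  case True
  show ?thesis by (rule grid_minimizer_descent_up[where h=h and \<Phi>=\<Phi>]) (use assms True in auto)
next
  case False
  let ?h = "\<lambda>t. - h (1 - t)" and ?\<Phi> = "\<lambda>t. \<Phi> (1 - t)"
  have "?\<Phi> (1 - v') \<le> ?\<Phi> (1 - v) - ((?h (1 - v))\<^sup>2 / (2 * \<rho>) - \<rho> / (real m)\<^sup>2)"
  proof (rule grid_minimizer_descent_up[where h="?h" and \<Phi>="?\<Phi>"])
    show "?h a \<le> ?h b" if "a \<le> b" for a b using mono[of "1 - b" "1 - a"] that by simp
    show "?h b - ?h a \<le> \<rho> * (b - a)" if "a \<le> b" for a b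
      using lip[of "1 - b" "1 - a"] that by simp
    show "?\<Phi> b - ?\<Phi> a \<le> ?h b * (b - a)" for a b
      using sub[of "1 - b" "1 - a"] by (simp add: algebra_simps)
    show "1 - v \<in> unit_grid m" "1 - v' \<in> unit_grid m"
      using unit_grid_reflect assms by blast+
    show "\<bar>?h (1 - v')\<bar> \<le> \<bar>?h w\<bar>" if "w \<in> unit_grid m" for w
      using opt[OF unit_grid_reflect[OF that \<open>m > 0\<close>]] by simp
    show "\<bar>1 - v' - (1 - v)\<bar> \<le> \<bar>w - (1 - v)\<bar>"
      if "w \<in> unit_grid m" "\<bar>?h w\<bar> = \<bar>?h (1 - v')\<bar>" for w
      using tie[OF unit_grid_reflect[OF that(1) \<open>m > 0\<close>]] that(2) by simp
    show "?h (1 - v) < 0" "?h 1 \<ge> 0" using assms False by auto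
  qed fact+
  then show ?thesis by simp
qed

section \<open>Coverage and loss under Lipschitz scores\<close>

text \<open>Loss and coverage depend only on the joint law of \<open>x\<close> and the score, so the
  data distribution is left out here. The kernel also carries the fact that scores lie in the unit
  interval.\<close>

locale score_model = prob_space P
  for P :: "('x \<times> real) measure" +
  fixes MX :: "'x measure" and K :: "'x \<Rightarrow> real measure" and \<rho> :: real
  assumes sets_P: "sets P = sets (MX \<Otimes>\<^sub>M borel)"
    and kernel: "conditional_score_distribution MX P K"
    and lipschitz: "lipschitz_scores \<rho> MX K"
    and continuous: "continuous_scores MX K"
    and rho_pos: "\<rho> > 0"
begin

section \<open>Conditional laws of the score\<close>

lemma space_P: "space P = space MX \<times> UNIV"
  using sets_eq_imp_space_eq[OF sets_P] by (simp add: space_pair_measure)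

lemma measurable_P [measurable_cong]: "sets P = sets (MX \<Otimes>\<^sub>M borel)"
  by (rule sets_P)

lemma measurable_fst_P [measurable]: "fst \<in> P \<rightarrow>\<^sub>M MX"
  and measurable_snd_P [measurable]: "snd \<in> borel_measurable P"
  unfolding measurable_cong_sets[OF sets_P refl] by simp_all

lemma Times_in_P [measurable]: "A \<in> sets MX \<Longrightarrow> B \<in> sets borel \<Longrightarrow> A \<times> B \<in> sets P"
  unfolding sets_P by (rule pair_measureI)

lemma prob_space_K: "x \<in> space MX \<Longrightarrow> prob_space (K x)"
  and sets_K: "x \<in> space MX \<Longrightarrow> sets (K x) = sets borel"
  using kernel by (auto simp: conditional_score_distribution_def space_prob_algebra dest!: measurable_space)

lemma finite_borel_measure_K:
  assumes "x \<in> space MX" shows "finite_borel_measure (K x)"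
  using prob_space_K[OF assms] sets_K[OF assms]
  by (simp add: finite_borel_measure_def finite_borel_measure_axioms_def prob_space_def)

lemma measure_K_singleton:
  assumes "x \<in> space MX" shows "measure (K x) {a} = 0"
  using continuous assms finite_borel_measure.isCont_cdf[OF finite_borel_measure_K[OF assms]]
  by (auto simp: continuous_scores_def continuous_on_eq_continuous_at)

lemma measure_K_Int_unit:
  assumes x: "x \<in> space MX" and B: "B \<in> sets borel"
  shows "measure (K x) B = measure (K x) (B \<inter> {0..1})"
proof -
  interpret Kx: prob_space "K x" by (rule prob_space_K[OF x])
  have [simp]: "sets (K x) = sets borel" by (rule sets_K[OF x])
  have "measure (K x) {0..1} = 1"
    using kernel x by (simp add: conditional_score_distribution_def)
  then have "AE r in K x. r \<in> {0..1}" by (subst Kx.prob_eq_1[symmetric]) auto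
  then show ?thesis using B by (intro Kx.finite_measure_eq_AE) auto
qed

text \<open>Only an atom at 0 could contribute, and continuity excludes it. The Lipschitz condition
  cannot: it compares thresholds from 0 upwards and does not see mass at 0 itself.\<close>

lemma measure_K_atMost_0:
  assumes "x \<in> space MX" shows "measure (K x) {..0} = 0"
proof -
  have "{..0} \<inter> {0..1} = {0::real}" by auto
  then show ?thesis
    using measure_K_Int_unit[OF assms, of "{..0}"] measure_K_singleton[OF assms, of 0] by simp
qed

text \<open>Clamping to the unit interval extends the Lipschitz bound to all real thresholds, the
  form that the descent lemmas require.\<close>

lemma measure_K_Ioc_le:
  assumes x: "x \<in> space MX" and "a \<le> b"
  shows "measure (K x) {a<..b} \<le> \<rho> * (b - a)"
proof -
  interpret Kx: finite_borel_measure "K x" by (rule finite_borel_measure_K[OF x])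
  define a' b' where "a' = max a 0" and "b' = min b 1"
  show ?thesis
  proof (cases "a' \<le> b'")
    case True
    have "measure (K x) {a<..b} = measure (K x) ({a<..b} \<inter> {0..1})"
      by (rule measure_K_Int_unit[OF x]) simp
    \<comment> \<open>For \<open>a < 0\<close> the clamped left end \<open>a' = 0\<close> belongs to
      the intersection; hence the extra singleton, which is null.\<close>
    also have "\<dots> \<le> measure (K x) ({a'} \<union> {a'<..b'})"
      by (rule Kx.finite_measure_mono) (auto simp: a'_def b'_def sets_K[OF x])
    also have "\<dots> \<le> measure (K x) {a'} + measure (K x) {a'<..b'}"
      by (rule measure_Un_le) (auto simp: sets_K[OF x])
    also have "\<dots> = cdf (K x) b' - cdf (K x) a'"
      using True measure_K_singleton[OF x] Kx.cdf_diff_eq[of a' b'] by (cases "a' = b'") auto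
    also have "\<dots> \<le> \<rho> * (b' - a')"
      using lipschitz x True by (simp add: lipschitz_scores_def a'_def b'_def)
    also have "\<dots> \<le> \<rho> * (b - a)"
      using rho_pos by (intro mult_left_mono) (auto simp: a'_def b'_def)
    finally show ?thesis .
  next
    case False
    then have "{a<..b} \<inter> {0..1} = {}" using \<open>a \<le> b\<close> by (auto simp: a'_def b'_def max_def min_def split: if_splits)
    then have "measure (K x) {a<..b} = 0" using measure_K_Int_unit[OF x, of "{a<..b}"] by simp
    then show ?thesis using rho_pos \<open>a \<le> b\<close> by simp
  qed
qed

lemma emeasure_Times:
  assumes "A \<in> sets MX" "B \<in> sets borel"
  shows "emeasure P (A \<times> B) = (\<integral>\<^sup>+x\<in>A. emeasure (K x) B \<partial>distr P MX fst)"
  using kernel assms by (simp add: conditional_score_distribution_def)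

text \<open>Integrating the kernel over \<open>A\<close> turns a bound that is uniform in
  \<open>x\<close> into one on the joint law. With \<open>c = 0\<close> it also yields null
  sets.\<close>

lemma measure_Times_le:
  assumes A: "A \<in> sets MX" and B: "B \<in> sets borel" and "c \<ge> 0"
    and le: "\<And>x. x \<in> space MX \<Longrightarrow> measure (K x) B \<le> c"
  shows "measure P (A \<times> B) \<le> c * measure P (A \<times> UNIV)"
proof -
  have K_le: "emeasure (K x) B \<le> ennreal c" if "x \<in> space MX" for x
    using le[OF that] prob_space_K[OF that]
    by (simp add: finite_measure.emeasure_eq_measure prob_space.finite_measure ennreal_leI)
  have "emeasure P (A \<times> B) \<le> (\<integral>\<^sup>+x\<in>A. ennreal c \<partial>distr P MX fst)"
    unfolding emeasure_Times[OF A B]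
    by (intro nn_integral_mono) (auto simp: K_le split: split_indicator)
  also have "\<dots> = ennreal c * emeasure P (A \<times> UNIV)"
  proof -
    have "fst -` A \<inter> space P = A \<times> UNIV" using sets.sets_into_space[OF A] by (auto simp: space_P)
    then show ?thesis using A by (simp add: nn_integral_cmult_indicator emeasure_distr)
  qed
  finally have "ennreal (measure P (A \<times> B)) \<le> ennreal (c * measure P (A \<times> UNIV))"
    using \<open>c \<ge> 0\<close> by (simp add: emeasure_eq_measure ennreal_mult)
  then show ?thesis using \<open>c \<ge> 0\<close> by (subst (asm) ennreal_le_iff) auto
qed

lemma AE_score_unit: "AE z in P. snd z \<in> {0..1}"
proof -
  have "measure P (space MX \<times> - {0..1}) \<le> 0 * measure P (space MX \<times> UNIV)"
  proof (rule measure_Times_le)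
    show "measure (K x) (- {0..1}) \<le> 0" if "x \<in> space MX" for x
      using measure_K_Int_unit[OF that, of "- {0..1}"] by simp
  qed auto
  then have "prob (space MX \<times> - {0..1}) = 0" by (simp add: measure_le_0_iff)
  moreover have "space MX \<times> - {0..1} = {z \<in> space P. snd z \<notin> {0..1}}" by (auto simp: space_P)
  moreover have "space MX \<times> - {0..1::real} \<in> events" by measurable
  ultimately show ?thesis by (subst AE_iff_measurable[OF _ refl]) (auto simp: emeasure_eq_measure)
qed

text \<open>The distribution function of the score conditioned on \<open>B\<close>. Division by zero
  makes it 0 when \<open>B\<close> is null, so monotonicity and the Lipschitz bound hold without a
  positivity condition.\<close>

definition coverage :: "'x set \<Rightarrow> real \<Rightarrow> real" where
  "coverage B \<tau> = prob (B \<times> {..\<tau>}) / prob (B \<times> UNIV)"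

lemma coverage_mono:
  assumes "B \<in> sets MX" "a \<le> b" shows "coverage B a \<le> coverage B b"
  unfolding coverage_def using assms by (intro divide_right_mono finite_measure_mono) auto

lemma coverage_lipschitz:
  assumes B: "B \<in> sets MX" and "a \<le> b"
  shows "coverage B b - coverage B a \<le> \<rho> * (b - a)"
proof (cases "prob (B \<times> UNIV) = 0")
  case False
  then have p: "prob (B \<times> UNIV) > 0" by (simp add: zero_less_measure_iff)
  have "B \<times> {a<..b} = B \<times> {..b} - B \<times> {..a}" by auto
  moreover have "prob (B \<times> {..b} - B \<times> {..a}) = prob (B \<times> {..b}) - prob (B \<times> {..a})"
    using assms by (intro finite_measure_Diff) auto
  moreover have "prob (B \<times> {a<..b}) \<le> \<rho> * (b - a) * prob (B \<times> UNIV)"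
    using measure_K_Ioc_le rho_pos \<open>a \<le> b\<close> by (intro measure_Times_le B) auto
  ultimately show ?thesis using p by (simp add: coverage_def diff_divide_distrib[symmetric] divide_le_eq)
qed (use assms rho_pos in \<open>simp add: coverage_def\<close>)

lemma coverage_0: "B \<in> sets MX \<Longrightarrow> coverage B 0 = 0"
  using measure_Times_le[of B "{..0}" 0] measure_K_atMost_0
  by (simp add: coverage_def measure_le_0_iff)

lemma coverage_1:
  assumes B: "B \<in> sets MX" and "prob (B \<times> UNIV) > 0"
  shows "coverage B 1 = 1"
proof -
  have "prob (B \<times> {..1}) = prob (B \<times> UNIV)"
    using AE_score_unit B by (intro finite_measure_eq_AE) auto
  then show ?thesis using assms by (simp add: coverage_def)
qed

section \<open>Integrated pinball loss\<close>

lemma integrable_pinball: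
  assumes q: "q \<in> {0..1}" and [measurable]: "f \<in> borel_measurable MX" and "A \<in> sets MX"
    and "\<And>x. x \<in> space MX \<Longrightarrow> \<bar>f x\<bar> \<le> c"
  shows "integrable P (\<lambda>z. indicator A (fst z) * pinball_loss q (f (fst z)) (snd z))"
\<comment> \<open>The loss is at most the distance between threshold and score: \<open>c\<close>
  bounds the threshold, and the score is almost surely at most 1.\<close>
proof (rule integrable_const_bound[where B="c + 1"])
  note [measurable] = \<open>A \<in> sets MX\<close>
  show "(\<lambda>z. indicator A (fst z) * pinball_loss q (f (fst z)) (snd z)) \<in> borel_measurable P"
    by measurable
  show "AE z in P. norm (indicator A (fst z) * pinball_loss q (f (fst z)) (snd z)) \<le> c + 1"
    using AE_score_unit AE_space
  proof eventually_elim
    case (elim z)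
    then have "\<bar>f (fst z)\<bar> \<le> c" using assms by (auto simp: space_P)
    moreover have "\<bar>pinball_loss q (f (fst z)) (snd z)\<bar> \<le> \<bar>f (fst z) - snd z\<bar>"
      using pinball_le[OF q] pinball_nonneg[OF q] by simp
    ultimately show ?case using elim by (auto simp: abs_mult split: split_indicator)
  qed
qed

lemma PB_bounds:
  assumes q: "q \<in> {0..1}" and [measurable]: "f \<in> borel_measurable MX"
    and f: "\<And>x. x \<in> space MX \<Longrightarrow> f x \<in> {0..1}"
  shows "0 \<le> PB q P f" and "PB q P f \<le> 1"
proof -
  have PB: "PB q P f = (\<integral>z. pinball_loss q (f (fst z)) (snd z) \<partial>P)"
    by (simp add: PB_def case_prod_beta')
  show "0 \<le> PB q P f" unfolding PB by (simp add: pinball_nonneg[OF q])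
  have "AE z in P. pinball_loss q (f (fst z)) (snd z) \<le> 1"
    using AE_score_unit AE_space
  proof eventually_elim
    case (elim z)
    then have "f (fst z) \<in> {0..1}" using f by (auto simp: space_P)
    with elim have "\<bar>f (fst z) - snd z\<bar> \<le> 1" by (auto simp: abs_le_iff)
    then show ?case using pinball_le[OF q] order_trans by blast
  qed
  moreover have "integrable P (\<lambda>z. pinball_loss q (f (fst z)) (snd z))"
  proof -
    have "integrable P (\<lambda>z. indicator (space MX) (fst z) * pinball_loss q (f (fst z)) (snd z))"
      using f by (intro integrable_pinball[where c=1] q) auto
    then show ?thesis
      by (rule Bochner_Integration.integrable_cong[THEN iffD1, rotated -1]) (auto simp: space_P)
  qed
  ultimately have "PB q P f \<le> (\<integral>z. 1 \<partial>P)" unfolding PB by (intro integral_mono_AE) auto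
  then show "PB q P f \<le> 1" by (simp add: prob_space)
qed

text \<open>The conditional expected loss of the constant threshold \<tau> given \<open>B\<close>.
  Normalising by the probability of \<open>B\<close> makes \<open>coverage B \<tau> - q\<close> its
  subgradient.\<close>

definition set_loss :: "real \<Rightarrow> 'x set \<Rightarrow> real \<Rightarrow> real" where
  "set_loss q B \<tau> = (\<integral>z. indicator B (fst z) * pinball_loss q \<tau> (snd z) \<partial>P) / prob (B \<times> UNIV)"

lemma set_loss_subgradient:
  assumes q: "q \<in> {0..1}" and B: "B \<in> sets MX" and p: "prob (B \<times> UNIV) > 0"
  shows "set_loss q B b - set_loss q B a \<le> (coverage B b - q) * (b - a)"
proof -
  note [measurable] = B
  have int: "integrable P (\<lambda>z. indicator B (fst z) * pinball_loss q \<tau> (snd z))" for \<tau>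
    by (rule integrable_pinball[OF q, where c="\<bar>\<tau>\<bar>" and f="\<lambda>_. \<tau>"]) (use B in auto)
  have ind: "integrable P (\<lambda>z. (indicator (B \<times> A) z :: real))" if "A \<in> sets borel" for A
    using that B by (simp add: less_top[symmetric])
  let ?I = "\<lambda>A z. indicator (B \<times> A) z :: real"
  have "(\<integral>z. indicator B (fst z) * pinball_loss q b (snd z) \<partial>P)
        - (\<integral>z. indicator B (fst z) * pinball_loss q a (snd z) \<partial>P)
      = (\<integral>z. indicator B (fst z) * pinball_loss q b (snd z)
            - indicator B (fst z) * pinball_loss q a (snd z) \<partial>P)"
    by (rule Bochner_Integration.integral_diff[symmetric]) (rule int)+
  also have "\<dots> \<le> (\<integral>z. (b - a) * ?I {..b} z - (b - a) * q * ?I UNIV z \<partial>P)"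
  proof (rule integral_mono)
    fix z
    show "indicator B (fst z) * pinball_loss q b (snd z)
            - indicator B (fst z) * pinball_loss q a (snd z)
        \<le> (b - a) * ?I {..b} z - (b - a) * q * ?I UNIV z"
      using pinball_subgradient[of q b "snd z" a]
      by (cases z) (auto simp: indicator_def algebra_simps)
  qed (use int ind in auto)
  also have "\<dots> = (b - a) * prob (B \<times> {..b}) - (b - a) * q * prob (B \<times> UNIV)"
    using ind B by (subst Bochner_Integration.integral_diff) auto
  also have "\<dots> = (coverage B b - q) * (b - a) * prob (B \<times> UNIV)"
    using p by (simp add: coverage_def field_simps)
  finally show ?thesis
    using p by (simp add: set_loss_def diff_divide_distrib[symmetric] pos_divide_le_eq)
qed

text \<open>The update changes the loss only over \<open>B\<close>, where both the old and the new
  model are constant; the integral over the complement cancels.\<close>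

lemma PB_shift:
  assumes q: "q \<in> {0..1}" and f [measurable]: "f \<in> borel_measurable MX"
    and f01: "\<And>x. x \<in> space MX \<Longrightarrow> f x \<in> {0..1}"
    and B: "B \<in> sets MX" and fB: "\<And>x. x \<in> B \<Longrightarrow> f x = v" and p: "prob (B \<times> UNIV) > 0"
  shows "PB q P (\<lambda>x. if x \<in> B then f x + \<Delta> else f x) =
    PB q P f + prob (B \<times> UNIV) * (set_loss q B (v + \<Delta>) - set_loss q B v)"
proof -
  note [measurable] = B
  have int: "integrable P (\<lambda>z. indicator B (fst z) * pinball_loss q \<tau> (snd z))" for \<tau>
    by (rule integrable_pinball[OF q, where c="\<bar>\<tau>\<bar>" and f="\<lambda>_. \<tau>"]) (use B in auto)
  have intf: "integrable P (\<lambda>z. indicator A (fst z) * pinball_loss q (f (fst z)) (snd z))"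
    if "A \<in> sets MX" for A
    using that f01 by (intro integrable_pinball[OF q f, where c=1]) auto
  let ?R = "\<lambda>z. indicator (space MX - B) (fst z) * pinball_loss q (f (fst z)) (snd z)"
  have split: "PB q P h = (\<integral>z. ?R z \<partial>P) + prob (B \<times> UNIV) * set_loss q B \<tau>"
    if "\<And>x. x \<in> B \<Longrightarrow> h x = \<tau>" "\<And>x. x \<notin> B \<Longrightarrow> h x = f x" for h \<tau>
  proof -
    have "PB q P h = (\<integral>z. ?R z + indicator B (fst z) * pinball_loss q \<tau> (snd z) \<partial>P)"
      unfolding PB_def case_prod_beta'
      by (rule Bochner_Integration.integral_cong) (auto simp: space_P that indicator_def)
    also have "\<dots> = (\<integral>z. ?R z \<partial>P) + (\<integral>z. indicator B (fst z) * pinball_loss q \<tau> (snd z) \<partial>P)"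
      by (rule Bochner_Integration.integral_add) (use intf int in auto)
    finally show ?thesis using p by (simp add: set_loss_def)
  qed
  show ?thesis
    using split[of f v] split[of "\<lambda>x. if x \<in> B then f x + \<Delta> else f x" "v + \<Delta>"] fB
    by (simp add: algebra_simps)
qed

end

section \<open>One round of the algorithm\<close>

context score_model
begin

section \<open>Calibration expressed through coverage\<close>

lemma measure_fst_eq: "\<P>((x, r) in P. Q x) = prob ({x \<in> space MX. Q x} \<times> UNIV)"
  by (rule arg_cong[where f=prob]) (auto simp: space_P)

lemma coverage_shift_eq:
  assumes "B \<subseteq> space MX" and "\<And>x. x \<in> B \<Longrightarrow> f x = v"
  shows "\<P>((x, r) in P. r \<le> f x + \<Delta> \<bar> x \<in> B) = coverage B (v + \<Delta>)"
  unfolding cond_prob_def coverage_def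
  by (rule arg_cong2[where f="(/)"]; rule arg_cong[where f=prob]) (use assms in \<open>auto simp: space_P\<close>)

lemma coverage_group_eq:
  "\<P>((x, r) in P. r \<le> f x \<bar> f x = v \<and> g x = 1) = coverage {x \<in> space MX. f x = v \<and> g x = 1} v"
  unfolding cond_prob_def coverage_def
  by (rule arg_cong2[where f="(/)"]; rule arg_cong[where f=prob]) (auto simp: space_P)

lemma weighted_bias_eq:
  "weighted_bias P q f v g = prob ({x \<in> space MX. f x = v \<and> g x = 1} \<times> UNIV) *
     (q - coverage {x \<in> space MX. f x = v \<and> g x = 1} v)\<^sup>2"
  unfolding weighted_bias_def coverage_group_eq measure_fst_eq ..

text \<open>Every conditional weight has the denominator Pr[g = 1]. Extracting it reduces the
  calibration condition to a bound by \<alpha> on a sum of weighted biases.\<close>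

lemma calibration_error_eq:
  "calibration_error MX P q f g =
    (\<Sum>v\<in>f ` space MX. weighted_bias P q f v g) / \<P>((x, r) in P. g x = 1)"
  unfolding calibration_error_def weighted_bias_def sum_divide_distrib
  by (intro sum.cong refl) (simp add: cond_prob_def case_prod_beta')

lemma quantile_multicalibrated_iff:
  assumes "finite (f ` space MX)" "f ` space MX \<subseteq> {0..1}"
  shows "quantile_multicalibrated MX P \<alpha> q G f \<longleftrightarrow>
    (\<forall>g\<in>G. \<P>((x, r) in P. g x = 1) > 0 \<longrightarrow> (\<Sum>v\<in>f ` space MX. weighted_bias P q f v g) \<le> \<alpha>)"
  using assms by (auto simp: quantile_multicalibrated_def calibration_error_eq divide_le_cancel)

lemma weighted_bias_nonneg: "0 \<le> weighted_bias P q f v g"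
  by (simp add: weighted_bias_eq)

lemma coverage_bounds: "B \<in> sets MX \<Longrightarrow> 0 \<le> coverage B \<tau> \<and> coverage B \<tau> \<le> 1"
  unfolding coverage_def by (auto intro!: divide_le_eq_1[THEN iffD2] finite_measure_mono simp: less_le)

lemma level_set_measurable:
  fixes f :: "'x \<Rightarrow> real" and g :: "'x \<Rightarrow> nat"
  assumes [measurable]: "f \<in> borel_measurable MX" and g: "g \<in> MX \<rightarrow>\<^sub>M count_space {0, 1}"
  shows "{x \<in> space MX. f x = v \<and> g x = 1} \<in> sets MX"
proof -
  have "g -` {1} \<inter> space MX \<in> sets MX" by (rule measurable_sets[OF g]) auto
  then have "{x \<in> space MX. f x = v} \<inter> (g -` {1} \<inter> space MX) \<in> sets MX" by measurable
  then show ?thesis by (rule back_subst[of "\<lambda>A. A \<in> sets MX"]) auto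
qed

text \<open>A single term of a sum of nonnegative weighted biases is at most the whole sum, hence at
  most \<alpha>; dividing by the probability and taking roots gives the bound.\<close>

lemma multicalibrated_conditional_bias:
  assumes cal: "quantile_multicalibrated MX P \<alpha> q G f" and g: "g \<in> G"
    and fm: "f \<in> borel_measurable MX" and gm: "g \<in> MX \<rightarrow>\<^sub>M count_space {0, 1}"
    and v: "v \<in> f ` space MX" and pos: "\<P>((x, r) in P. g x = 1 \<and> f x = v) > 0"
  shows "\<bar>\<P>((x, r) in P. r \<le> f x \<bar> g x = 1 \<and> f x = v) - q\<bar>
    \<le> sqrt \<alpha> / sqrt (\<P>((x, r) in P. g x = 1 \<and> f x = v))"
proof -
  let ?p = "\<P>((x, r) in P. g x = 1 \<and> f x = v)"
  let ?c = "\<P>((x, r) in P. r \<le> f x \<bar> g x = 1 \<and> f x = v)"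
  have fin: "finite (f ` space MX)" "f ` space MX \<subseteq> {0..1}"
    using cal by (auto simp: quantile_multicalibrated_def)
  have "{x \<in> space MX. g x = 1} \<in> sets MX"
    using level_set_measurable[of "\<lambda>_. 0" g 0] gm by simp
  then have "?p \<le> \<P>((x, r) in P. g x = 1)"
    unfolding measure_fst_eq by (intro finite_measure_mono) auto
  then have "(\<Sum>v\<in>f ` space MX. weighted_bias P q f v g) \<le> \<alpha>"
    using cal g pos quantile_multicalibrated_iff[OF fin] by force
  moreover have "weighted_bias P q f v g \<le> (\<Sum>v\<in>f ` space MX. weighted_bias P q f v g)"
    by (rule member_le_sum[OF v weighted_bias_nonneg fin(1)])
  ultimately have "?p * (?c - q)\<^sup>2 \<le> \<alpha>"
    by (simp add: weighted_bias_def conj_commute power2_commute)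
  then have "(?c - q)\<^sup>2 \<le> \<alpha> / ?p" using pos by (simp add: pos_le_divide_eq mult.commute)
  then have "\<bar>?c - q\<bar> \<le> sqrt (\<alpha> / ?p)" by (rule real_le_rsqrt[of "\<bar>_\<bar>", simplified])
  then show ?thesis by (simp add: real_sqrt_divide)
qed

text \<open>For some violated group the biases sum to more than \<alpha>. Extending the sum from the
  range of \<open>f\<close> to the grid adds only nonnegative terms, and at most
  \<open>m + 1\<close> terms result, none above the maximum.\<close>

lemma max_bias_gt:
  assumes nocal: "\<not> quantile_multicalibrated MX P \<alpha> q G f"
    and grid: "f ` space MX \<subseteq> unit_grid m" and "\<alpha> > 0"
    and max: "is_arg_max (\<lambda>(v, g). weighted_bias P q f v g) (\<lambda>(v, g). v \<in> unit_grid m \<and> g \<in> G) (v, g)"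
  shows "weighted_bias P q f v g > \<alpha> / (real m + 1)"
proof -
  have fin: "finite (f ` space MX)" "f ` space MX \<subseteq> {0..1}"
    using grid finite_subset finite_unit_grid unit_grid_bounds by (blast, force)
  obtain g' where g': "g' \<in> G" "(\<Sum>u\<in>f ` space MX. weighted_bias P q f u g') > \<alpha>"
    using nocal quantile_multicalibrated_iff[OF fin] by (auto simp: not_le)
  have le: "weighted_bias P q f u g' \<le> weighted_bias P q f v g" if "u \<in> unit_grid m" for u
    using max that g' by (auto simp: is_arg_max_def not_less)
  have "\<alpha> < (\<Sum>u\<in>f ` space MX. weighted_bias P q f u g')" by (rule g')
  also have "\<dots> \<le> (\<Sum>u\<in>unit_grid m. weighted_bias P q f u g')"
    by (rule sum_mono2) (use grid weighted_bias_nonneg in auto)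
  also have "\<dots> \<le> (\<Sum>u\<in>unit_grid m. weighted_bias P q f v g)" by (rule sum_mono) (rule le)
  also have "\<dots> = real (card (unit_grid m)) * weighted_bias P q f v g" by simp
  also have "\<dots> \<le> (real m + 1) * weighted_bias P q f v g"
    using card_unit_grid_le[of m] weighted_bias_nonneg by (intro mult_right_mono) auto
  finally show ?thesis by (simp add: pos_divide_less_eq mult.commute)
qed

text \<open>Measurability and grid values are kept so that rounds can be iterated; the third
  conclusion makes the pinball loss a potential function.\<close>

lemma step_decreases_PB:
  assumes q: "q \<in> {0..1}" and "\<alpha> > 0" and m: "real m = 8 * \<rho>\<^sup>2 / \<alpha>"
    and G: "\<And>g. g \<in> G \<Longrightarrow> g \<in> MX \<rightarrow>\<^sub>M count_space {0, 1}"
    and fm: "f \<in> borel_measurable MX" and grid: "f ` space MX \<subseteq> unit_grid m"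
    and nocal: "\<not> quantile_multicalibrated MX P \<alpha> q G f"
    and step: "batch_mvp_step MX P q G m f f'"
  shows "f' \<in> borel_measurable MX" and "f' ` space MX \<subseteq> unit_grid m"
    and "PB q P f' \<le> PB q P f - \<alpha>\<^sup>2 / (32 * \<rho> ^ 3)"
proof -
  have "m > 0" using m \<open>\<alpha> > 0\<close> rho_pos by (cases "m = 0") auto
  obtain v g \<Delta> B where
      max: "is_arg_max (\<lambda>(v, g). weighted_bias P q f v g) (\<lambda>(v, g). v \<in> unit_grid m \<and> g \<in> G) (v, g)"
    and B_def: "B = {x \<in> space MX. f x = v \<and> g x = 1}"
    and shift: "coverage_shift P q m f v B \<Delta>"
    and f': "f' = (\<lambda>x. if x \<in> B then f x + \<Delta> else f x)"
    using step by (auto simp: batch_mvp_step_def)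
  have v: "v \<in> unit_grid m" and "g \<in> G" using max by (auto simp: is_arg_max_def)
  have B: "B \<in> sets MX" unfolding B_def by (rule level_set_measurable[OF fm G[OF \<open>g \<in> G\<close>]])
  have fB: "f x = v" if "x \<in> B" for x using that by (simp add: B_def)
  have cov: "\<P>((x, r) in P. r \<le> f x + \<Delta> \<bar> x \<in> B) = coverage B (v + \<Delta>)" for \<Delta>
    by (rule coverage_shift_eq) (auto simp: B_def)
  have v': "v + \<Delta> \<in> unit_grid m"
    and opt: "\<And>\<Delta>'. v + \<Delta>' \<in> unit_grid m \<Longrightarrow> \<bar>coverage B (v + \<Delta>) - q\<bar> \<le> \<bar>coverage B (v + \<Delta>') - q\<bar>"
    and tie: "\<And>\<Delta>'. v + \<Delta>' \<in> unit_grid m \<Longrightarrow> \<bar>coverage B (v + \<Delta>') - q\<bar> = \<bar>coverage B (v + \<Delta>) - q\<bar>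
      \<Longrightarrow> \<bar>\<Delta>\<bar> \<le> \<bar>\<Delta>'\<bar>"
    using shift unfolding coverage_shift_def is_arg_min_def cov by (auto simp: not_less)
  show "f' \<in> borel_measurable MX" unfolding f' using fm B by measurable
  show "f' ` space MX \<subseteq> unit_grid m" using grid v' fB by (auto simp: f')
  define p d where "p = prob (B \<times> UNIV)" and "d = coverage B v - q"
  have "p * d\<^sup>2 = weighted_bias P q f v g"
    by (simp add: weighted_bias_eq B_def p_def d_def power2_commute)
  with max_bias_gt[OF nocal grid \<open>\<alpha> > 0\<close> max] have bias: "p * d\<^sup>2 > \<alpha> / (real m + 1)" by simp
  \<comment> \<open>The chosen set has positive probability and nonzero bias, so its coverage really
    runs from 0 to 1 and \<open>grid_minimizer_descent\<close> applies.\<close>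
  then have "p * d\<^sup>2 > 0" using \<open>\<alpha> > 0\<close> by (smt (verit) divide_pos_pos of_nat_0_le_iff)
  then have "p > 0" "d \<noteq> 0" by (auto simp: zero_less_mult_iff p_def)
  have "p \<le> 1" by (simp add: p_def)
  have cov0: "coverage B 0 = 0" and cov1: "coverage B 1 = 1"
    using coverage_0[OF B] coverage_1[OF B] \<open>p > 0\<close> by (auto simp: p_def)
  have "set_loss q B (v + \<Delta>)
      \<le> set_loss q B v - ((coverage B v - q)\<^sup>2 / (2 * \<rho>) - \<rho> / (real m)\<^sup>2)"
  proof (rule grid_minimizer_descent[where h="\<lambda>\<tau>. coverage B \<tau> - q"])
    show "coverage B a - q \<le> coverage B b - q" if "a \<le> b" for a b
      using coverage_mono[OF B that] by simp
    show "coverage B b - q - (coverage B a - q) \<le> \<rho> * (b - a)" if "a \<le> b" for a b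
      using coverage_lipschitz[OF B that] by simp
    show "set_loss q B b - set_loss q B a \<le> (coverage B b - q) * (b - a)" for a b
      using set_loss_subgradient[OF q B] \<open>p > 0\<close> by (simp add: p_def)
    show "\<bar>coverage B (v + \<Delta>) - q\<bar> \<le> \<bar>coverage B w - q\<bar>" if "w \<in> unit_grid m" for w
      using opt[of "w - v"] that by simp
    show "\<bar>v + \<Delta> - v\<bar> \<le> \<bar>w - v\<bar>"
      if "w \<in> unit_grid m" "\<bar>coverage B w - q\<bar> = \<bar>coverage B (v + \<Delta>) - q\<bar>" for w
      using tie[of "w - v"] that by simp
  qed (use \<open>d \<noteq> 0\<close> q cov0 cov1 v v' \<open>m > 0\<close> rho_pos in \<open>auto simp: d_def\<close>)
  then have "p * (set_loss q B (v + \<Delta>) - set_loss q B v) \<le> p * - (d\<^sup>2 / (2 * \<rho>) - \<rho> / (real m)\<^sup>2)"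
    using \<open>p > 0\<close> by (intro mult_left_mono) (auto simp: d_def)
  also have "\<dots> = p * (\<rho> / (real m)\<^sup>2) - p * d\<^sup>2 / (2 * \<rho>)" by (simp add: algebra_simps)
  also have "\<dots> \<le> \<rho> / (real m)\<^sup>2 - \<alpha> / (real m + 1) / (2 * \<rho>)"
    using \<open>p \<le> 1\<close> \<open>p > 0\<close> rho_pos bias
    by (intro diff_mono divide_right_mono mult_left_le_one_le) auto
  also have "\<dots> \<le> - (\<alpha>\<^sup>2 / (32 * \<rho> ^ 3))"
  proof -
    \<comment> \<open>Coverage climbs from 0 to 1 over an interval of length 1.\<close>
    have "1 \<le> \<rho>" using coverage_lipschitz[OF B, of 0 1] cov0 cov1 by simp
    have "\<bar>d\<bar> \<le> 1" using coverage_bounds[OF B, of v] q by (auto simp: d_def abs_le_iff)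
    then have "d\<^sup>2 \<le> 1" by (simp add: abs_square_le_1)
    then have "p * d\<^sup>2 \<le> 1" using \<open>p \<le> 1\<close> \<open>p > 0\<close> by (simp add: mult_le_one)
    with bias have "\<alpha> / (real m + 1) < 1" by linarith
    \<comment> \<open>A weighted bias never exceeds 1. Combined with
      \<open>\<alpha> * m = 8 * \<rho>\<^sup>2 \<ge> 8\<close>, this gives
      \<open>m * (m + 1) > 8\<close>.\<close>
    then have "\<alpha> < real m + 1" by (simp add: divide_less_eq)
    have \<alpha>: "\<alpha> = 8 * \<rho>\<^sup>2 / real m" using m \<open>m > 0\<close> \<open>\<alpha> > 0\<close> by (simp add: field_simps)
    have "8 \<le> 8 * \<rho>\<^sup>2" using \<open>1 \<le> \<rho>\<close> by simp
    also have "\<dots> < real m * (real m + 1)"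
      using \<open>\<alpha> < real m + 1\<close> \<open>m > 0\<close> by (simp add: \<alpha> field_simps)
    finally have "real 8 < real (m * (m + 1))" by (simp add: algebra_simps)
    then have "8 < m * (m + 1)" by (simp only: of_nat_less_iff)
    have "m \<ge> 3"
    proof (rule ccontr)
      assume "\<not> m \<ge> 3"
      then have "m * (m + 1) \<le> 2 * 3" by (intro mult_mono) auto
      with \<open>8 < m * (m + 1)\<close> show False by simp
    qed
    \<comment> \<open>In terms of \<open>m\<close>, the gain is
      \<open>4 * \<rho> / (m * (m + 1))\<close>, the rounding cost \<open>\<rho> / m\<^sup>2\<close>
      and the target \<open>2 * \<rho> / m\<^sup>2\<close>. Gain minus cost reaches the target
      exactly when this inequality, equivalent to \<open>m \<ge> 3\<close>, holds.\<close>
    have "3 / real m \<le> 4 / (real m + 1)" using \<open>m \<ge> 3\<close> by (simp add: field_simps)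
    then have "\<rho> / real m * (3 / real m) \<le> \<rho> / real m * (4 / (real m + 1))"
      using rho_pos by (intro mult_left_mono) auto
    moreover have "\<alpha>\<^sup>2 / (32 * \<rho> ^ 3) = 2 * \<rho> / (real m)\<^sup>2"
      using rho_pos \<open>m > 0\<close> by (simp add: \<alpha> field_simps power2_eq_square power3_eq_cube)
    moreover have "\<alpha> / n / (2 * \<rho>) = \<rho> / real m * (4 / n)" if "n > 0" for n
      using rho_pos \<open>m > 0\<close> that by (simp add: \<alpha> field_simps power2_eq_square)
    then have "\<alpha> / (real m + 1) / (2 * \<rho>) = \<rho> / real m * (4 / (real m + 1))" by simp
    ultimately show ?thesis by (simp add: power2_eq_square)
  qed
  finally have "p * (set_loss q B (v + \<Delta>) - set_loss q B v) \<le> - (\<alpha>\<^sup>2 / (32 * \<rho> ^ 3))" .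
  moreover have "PB q P f' = PB q P f + p * (set_loss q B (v + \<Delta>) - set_loss q B v)"
    unfolding f' p_def
    by (rule PB_shift[OF q fm _ B fB])
      (use grid unit_grid_bounds \<open>p > 0\<close> in \<open>force simp: p_def\<close>)+
  ultimately show "PB q P f' \<le> PB q P f - \<alpha>\<^sup>2 / (32 * \<rho> ^ 3)" by simp
qed

lemma step_exists:
  assumes nocal: "\<not> quantile_multicalibrated MX P \<alpha> q G f"
    and grid: "f ` space MX \<subseteq> unit_grid m" and "finite G"
  shows "\<exists>f'. batch_mvp_step MX P q G m f f'"
proof -
  have fin: "finite (f ` space MX)" "f ` space MX \<subseteq> {0..1}"
    using grid finite_subset finite_unit_grid unit_grid_bounds by (blast, force)
  \<comment> \<open>Over an empty collection every model with values on the grid is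
    calibrated.\<close>
  then have "G \<noteq> {}" using nocal quantile_multicalibrated_iff by auto
  let ?w = "\<lambda>(v, g). weighted_bias P q f v g"
  let ?VG = "unit_grid m \<times> G"
  have "0 / real m \<in> unit_grid m" unfolding unit_grid_def by auto
  then have "finite (?w ` ?VG)" "?w ` ?VG \<noteq> {}" using \<open>finite G\<close> \<open>G \<noteq> {}\<close> by auto
  then have "Max (?w ` ?VG) \<in> ?w ` ?VG" by (rule Max_in)
  then obtain v g where vg: "v \<in> unit_grid m" "g \<in> G" "?w (v, g) = Max (?w ` ?VG)" by auto
  have "is_arg_max ?w (\<lambda>(v, g). v \<in> unit_grid m \<and> g \<in> G) (v, g)"
    using vg \<open>finite (?w ` ?VG)\<close> by (fastforce simp: is_arg_max_linorder intro!: Max_ge)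
  moreover define B where "B = {x \<in> space MX. f x = v \<and> g x = 1}"
  moreover have "\<exists>\<Delta>. coverage_shift P q m f v B \<Delta>"
  proof -
    \<comment> \<open>The admissible shifts are a translate of the grid. Finiteness gives a nonempty
      finite set of coverage minimisers, and among them one of least absolute value.\<close>
    let ?D = "(\<lambda>w. w - v) ` unit_grid m"
    let ?c = "\<lambda>\<Delta>. \<bar>\<P>((x, r) in P. r \<le> f x + \<Delta> \<bar> x \<in> B) - q\<bar>"
    let ?Q = "is_arg_min ?c (\<lambda>\<Delta>. v + \<Delta> \<in> unit_grid m)"
    have D: "{\<Delta>. v + \<Delta> \<in> unit_grid m} = ?D" by force
    have "finite ?D" "?D \<noteq> {}" using vg by auto
    from ex_is_arg_min_if_finite[OF this, of ?c] have "{\<Delta>. ?Q \<Delta>} \<noteq> {}"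
      by (simp add: D[symmetric])
    moreover have "{\<Delta>. ?Q \<Delta>} \<subseteq> ?D" unfolding D[symmetric] by (auto simp: is_arg_min_def)
    then have "finite {\<Delta>. ?Q \<Delta>}" using \<open>finite ?D\<close> by (rule finite_subset)
    ultimately show ?thesis
      using ex_is_arg_min_if_finite[of "{\<Delta>. ?Q \<Delta>}" "\<lambda>\<Delta>. \<bar>\<Delta>\<bar>"] by (simp add: coverage_shift_def)
  qed
  ultimately show ?thesis unfolding batch_mvp_step_def by blast
qed

end

section \<open>Initial rounding and whole executions\<close>

lemma rounding_exists:
  assumes [measurable]: "f \<in> borel_measurable MX" and f: "\<And>x. x \<in> space MX \<Longrightarrow> f x \<in> {0..1}"
    and "m > 0"
  shows "\<exists>f\<^sub>0 :: 'x \<Rightarrow> real. f\<^sub>0 \<in> borel_measurable MX \<and>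
    (\<forall>x\<in>space MX. is_arg_min (\<lambda>v. \<bar>v - f x\<bar>) (\<lambda>v. v \<in> unit_grid m) (f\<^sub>0 x))"
proof (intro exI conjI ballI)
  \<comment> \<open>Rounding \<open>m * f x\<close> to the nearest integer resolves ties in a
    measurable way, as a run demands of its initial model.\<close>
  let ?r = "\<lambda>x. real_of_int (round (real m * f x)) / real m"
  show "?r \<in> borel_measurable MX" unfolding round_def by measurable
  fix x assume x: "x \<in> space MX"
  have "0 \<le> real m * f x" "real m * f x \<le> real m" using f[OF x] by (auto simp: mult_left_le)
  then have r: "0 \<le> round (real m * f x)" "round (real m * f x) \<le> int m"
    using round_mono[of 0 "real m * f x"] round_mono[of "real m * f x" "real m"] by auto
  then have "?r x = real (nat (round (real m * f x))) / real m" "nat (round (real m * f x)) \<le> m" by auto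
  then have "?r x \<in> unit_grid m" unfolding unit_grid_def by auto
  moreover have "\<bar>?r x - f x\<bar> \<le> \<bar>w - f x\<bar>" if "w \<in> unit_grid m" for w
  proof -
    have scale: "\<bar>a / real m - f x\<bar> = \<bar>real m * f x - a\<bar> / real m" for a
      using \<open>m > 0\<close> by (simp add: abs_minus_commute field_simps flip: abs_mult_pos')
    obtain i where i: "w = real i / real m" using \<open>w \<in> unit_grid m\<close> by (auto simp: unit_grid_def)
    have "\<bar>real m * f x - real_of_int (round (real m * f x))\<bar> \<le> \<bar>real m * f x - real_of_int (int i)\<bar>"
      by (rule round_diff_minimal)
    then show ?thesis unfolding i scale by (intro divide_right_mono) auto
  qed
  ultimately show "is_arg_min (\<lambda>v. \<bar>v - f x\<bar>) (\<lambda>v. v \<in> unit_grid m) (?r x)"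
    by (auto simp: is_arg_min_def not_less)
qed

text \<open>The existence of a run keeps the claim about all runs from being vacuous. That claim
  covers every choice among optimal roundings and optimal pairs of value and group.\<close>

theorem theorem3p2:
  fixes MX :: "'x measure" and MY :: "'y measure" and D :: "('x \<times> 'y) measure"
    and s :: "'x \<Rightarrow> 'y \<Rightarrow> real" and S :: "('x \<times> real) measure" and K :: "'x \<Rightarrow> real measure"
    and \<alpha> \<rho> q :: real and m :: nat and G :: "('x \<Rightarrow> nat) set" and f :: "'x \<Rightarrow> real"
  assumes "prob_space D" and "sets D = sets (MX \<Otimes>\<^sub>M MY)"
    and "case_prod s \<in> borel_measurable (MX \<Otimes>\<^sub>M MY)"
    and "\<And>x y. x \<in> space MX \<Longrightarrow> y \<in> space MY \<Longrightarrow> s x y \<in> {0..1}"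
    and "S = score_distribution MX D s"
    and "conditional_score_distribution MX S K"
    and "\<alpha> > 0" and "\<rho> > 0" and "q \<in> {0..1}"
    and "finite G" and "\<And>g. g \<in> G \<Longrightarrow> g \<in> MX \<rightarrow>\<^sub>M count_space {0, 1}"
    and "f \<in> borel_measurable MX" and "\<And>x. x \<in> space MX \<Longrightarrow> f x \<in> {0..1}"
    and "lipschitz_scores \<rho> MX K" and "continuous_scores MX K"
    and "real m = 8 * \<rho>\<^sup>2 / \<alpha>"
  shows "(\<exists>F. batch_mvp_run MX f \<alpha> q G S m F) \<and>
    (\<forall>F. batch_mvp_run MX f \<alpha> q G S m F \<longrightarrow>
      (\<exists>T. batch_mvp_returns_after MX \<alpha> q G S F T \<and>
        real T \<le> 32 * \<rho> ^ 3 / \<alpha>\<^sup>2 \<and>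
        PB q S (F T) \<le> PB q S (F 0) - real T * (\<alpha>\<^sup>2 / (32 * \<rho> ^ 3)) \<and>
        quantile_multicalibrated MX S \<alpha> q G (F T) \<and>
        (\<forall>g\<in>G. \<forall>v\<in>F T ` space MX. \<P>((x, r) in S. g x = 1 \<and> F T x = v) > 0 \<longrightarrow>
           \<bar>\<P>((x, r) in S. r \<le> F T x \<bar> g x = 1 \<and> F T x = v) - q\<bar>
             \<le> sqrt \<alpha> / sqrt (\<P>((x, r) in S. g x = 1 \<and> F T x = v)) \<and>
           \<bar>\<P>((x, y) in D. y \<in> prediction_set MY s (F T) x \<bar> g x = 1 \<and> F T x = v) - q\<bar>
             \<le> sqrt \<alpha> / sqrt (\<P>((x, r) in S. g x = 1 \<and> F T x = v)))))"
proof -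
  interpret D: prob_space D by fact
  have map_meas: "(\<lambda>(x, y). (x, s x y)) \<in> D \<rightarrow>\<^sub>M MX \<Otimes>\<^sub>M borel"
    unfolding measurable_cong_sets[OF assms(2) refl] case_prod_beta'
    using assms(3) by (intro measurable_Pair) (auto simp: case_prod_beta')
  have sets_S: "sets S = sets (MX \<Otimes>\<^sub>M borel)"
    by (simp add: assms(5) score_distribution_def)
  have "prob_space S"
    unfolding assms(5) score_distribution_def by (rule D.prob_space_distr[OF map_meas])
  then interpret S: prob_space S .
  interpret S: score_model S MX K \<rho>
    by unfold_locales (use assms sets_S in auto)
  have "m > 0" using assms(7,8,16) by (cases "m = 0") auto
  note q = \<open>q \<in> {0..1}\<close>
  let ?cal = "quantile_multicalibrated MX S \<alpha> q G"
  let ?step = "batch_mvp_step MX S q G m"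
  let ?c = "\<alpha>\<^sup>2 / (32 * \<rho> ^ 3)"
  define inv where "inv f \<longleftrightarrow> f \<in> borel_measurable MX \<and> f ` space MX \<subseteq> unit_grid m" for f :: "'x \<Rightarrow> real"
  have step_inv: "inv f'" "PB q S f' \<le> PB q S f - ?c"
    if "inv f" "\<not> ?cal f" "?step f f'" for f f'
    using S.step_decreases_PB[OF q assms(7,16,11) _ _ that(2,3)] that(1) by (auto simp: inv_def)
  have PB01: "0 \<le> PB q S f" "PB q S f \<le> 1" if "inv f" for f
  proof -
    have f01: "f x \<in> {0..1}" if "x \<in> space MX" for x
      using \<open>inv f\<close> that unit_grid_bounds[of "f x" m] by (auto simp: inv_def)
    have fm: "f \<in> borel_measurable MX" using \<open>inv f\<close> by (simp add: inv_def)
    show "0 \<le> PB q S f" "PB q S f \<le> 1" using S.PB_bounds[OF q fm f01] by auto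
  qed
  \<comment> \<open>The score law is the image of \<open>D\<close> under
    \<open>(x, y) \<mapsto> (x, s x y)\<close>, and \<open>y\<close> lies in the prediction set iff
    its score is at most \<open>h x\<close>; so the events correspond by preimage.\<close>
  have D_eq: "\<P>((x, y) in D. y \<in> prediction_set MY s h x \<bar> g x = 1 \<and> h x = v)
      = \<P>((x, r) in S. r \<le> h x \<bar> g x = 1 \<and> h x = v)"
    if hm: "h \<in> borel_measurable MX" and "g \<in> G" for h g v
  proof -
    have space_D: "space D = space MX \<times> space MY"
      using sets_eq_imp_space_eq[OF assms(2)] by (simp add: space_pair_measure)
    have B: "{x \<in> space MX. h x = v \<and> g x = 1} \<in> sets MX" (is "?B \<in> _")
      by (rule S.level_set_measurable[OF hm assms(11)[OF \<open>g \<in> G\<close>]])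
    have transfer: "measure S A = measure D ((\<lambda>(x, y). (x, s x y)) -` A \<inter> space D)"
      if "A \<in> sets S" for A
      using measure_distr[OF map_meas] that unfolding sets_S
      by (simp add: assms(5) score_distribution_def)
    have "\<P>((x, r) in S. r \<le> h x \<and> g x = 1 \<and> h x = v) = measure S (?B \<times> {..v})"
      by (rule arg_cong[where f="measure S"]) (auto simp: S.space_P)
    also have "\<dots> = \<P>((x, y) in D. y \<in> prediction_set MY s h x \<and> g x = 1 \<and> h x = v)"
      using B by (subst transfer)
        (auto simp: space_D prediction_set_def intro!: arg_cong[where f="measure D"])
    finally have num: "\<P>((x, r) in S. r \<le> h x \<and> g x = 1 \<and> h x = v) = \<dots>" .
    have "\<P>((x, r) in S. g x = 1 \<and> h x = v) = measure S (?B \<times> UNIV)"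
      by (rule arg_cong[where f="measure S"]) (auto simp: S.space_P)
    also have "\<dots> = \<P>((x, y) in D. g x = 1 \<and> h x = v)"
      using B by (subst transfer) (auto simp: space_D intro!: arg_cong[where f="measure D"])
    finally show ?thesis using num by (simp add: cond_prob_def case_prod_beta')
  qed
  show ?thesis
  proof (intro conjI allI impI)
    obtain f\<^sub>0 where f\<^sub>0: "f\<^sub>0 \<in> borel_measurable MX"
      "\<forall>x\<in>space MX. is_arg_min (\<lambda>v. \<bar>v - f x\<bar>) (\<lambda>v. v \<in> unit_grid m) (f\<^sub>0 x)"
      using rounding_exists[OF assms(12,13) \<open>m > 0\<close>] by blast
    have "inv f\<^sub>0" using f\<^sub>0 by (auto simp: inv_def is_arg_min_def)
    \<comment> \<open>Dependent choice yields the whole sequence at once; the clause for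
      \<open>t = 0\<close> records the prescribed initial model.\<close>
    have "\<exists>F. \<forall>t. (inv (F t) \<and> (t = 0 \<longrightarrow> F t = f\<^sub>0)) \<and>
        (if ?cal (F t) then F (Suc t) = F t else ?step (F t) (F (Suc t)))"
    proof (rule dependent_nat_choice)
      show "\<exists>h. inv h \<and> (0 = (0::nat) \<longrightarrow> h = f\<^sub>0)" using \<open>inv f\<^sub>0\<close> by blast
      fix h t assume h: "inv h \<and> (t = (0::nat) \<longrightarrow> h = f\<^sub>0)"
      show "\<exists>h'. (inv h' \<and> (Suc t = 0 \<longrightarrow> h' = f\<^sub>0)) \<and> (if ?cal h then h' = h else ?step h h')"
      proof (cases "?cal h")
        case False
        have "h ` space MX \<subseteq> unit_grid m" using h by (simp add: inv_def)
        then obtain h' where "?step h h'" using S.step_exists[OF False _ assms(10)] by blast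
        moreover from this have "inv h'" using step_inv(1) h False by blast
        ultimately show ?thesis using False by (intro exI[of _ h']) simp
      qed (use h in auto)
    qed
    then obtain F where "F 0 = f\<^sub>0"
      and "\<forall>t. if ?cal (F t) then F (Suc t) = F t else ?step (F t) (F (Suc t))" by blast
    then show "\<exists>F. batch_mvp_run MX f \<alpha> q G S m F"
      using f\<^sub>0 unfolding batch_mvp_run_def by (intro exI[of _ F]) simp
  next
    fix F assume run: "batch_mvp_run MX f \<alpha> q G S m F"
    have inv: "inv (F t)" for t
    proof (induction t)
      case 0
      then show ?case using run by (auto simp: batch_mvp_run_def inv_def is_arg_min_def)
    next
      case (Suc t)
      then show ?case using run step_inv(1)[of "F t" "F (Suc t)"]
        by (cases "?cal (F t)") (auto simp: batch_mvp_run_def)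
    qed
    have decrease: "PB q S (F T) \<le> PB q S (F 0) - real T * ?c" if "\<forall>t<T. \<not> ?cal (F t)" for T
      using that
    proof (induction T)
      case (Suc T)
      then have "?step (F T) (F (Suc T))" using run by (auto simp: batch_mvp_run_def)
      then have "PB q S (F (Suc T)) \<le> PB q S (F T) - ?c" using step_inv(2)[OF inv] Suc by simp
      then show ?case using Suc by (simp add: algebra_simps add_divide_distrib)
    qed simp
    \<comment> \<open>The potential starts at most at 1, never falls below 0 and loses at least
      \<open>?c\<close> in each round.\<close>
    have bound: "real T \<le> 32 * \<rho> ^ 3 / \<alpha>\<^sup>2" if "\<forall>t<T. \<not> ?cal (F t)" for T
    proof -
      have "real T * ?c \<le> 1"
        using decrease[OF that] PB01(1)[OF inv[of T]] PB01(2)[OF inv[of 0]] by linarith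
      then show ?thesis using \<open>\<alpha> > 0\<close> \<open>\<rho> > 0\<close> by (simp add: field_simps)
    qed
    have ex: "\<exists>t. ?cal (F t)"
    proof (rule ccontr)
      assume "\<nexists>t. ?cal (F t)"
      then have "real T \<le> 32 * \<rho> ^ 3 / \<alpha>\<^sup>2" for T using bound by blast
      then show False using reals_Archimedean2 not_le by blast
    qed
    \<comment> \<open>The least calibrated index, so that each of the \<open>T\<close> earlier
      rounds really executes the loop body.\<close>
    define T where "T = (LEAST t. ?cal (F t))"
    have cal: "?cal (F T)" unfolding T_def using ex by (rule LeastI_ex)
    have nocal: "\<forall>t<T. \<not> ?cal (F t)" unfolding T_def using not_less_Least by blast
    have FT: "F T \<in> borel_measurable MX" using inv by (simp add: inv_def)
    have bias: "\<bar>\<P>((x, r) in S. r \<le> F T x \<bar> g x = 1 \<and> F T x = v) - q\<bar>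
        \<le> sqrt \<alpha> / sqrt (\<P>((x, r) in S. g x = 1 \<and> F T x = v))"
      if "g \<in> G" "v \<in> F T ` space MX" "\<P>((x, r) in S. g x = 1 \<and> F T x = v) > 0" for g v
      by (rule S.multicalibrated_conditional_bias[OF cal that(1) FT assms(11)[OF that(1)] that(2,3)])
    show "\<exists>T. batch_mvp_returns_after MX \<alpha> q G S F T \<and>
        real T \<le> 32 * \<rho> ^ 3 / \<alpha>\<^sup>2 \<and>
        PB q S (F T) \<le> PB q S (F 0) - real T * (\<alpha>\<^sup>2 / (32 * \<rho> ^ 3)) \<and>
        quantile_multicalibrated MX S \<alpha> q G (F T) \<and>
        (\<forall>g\<in>G. \<forall>v\<in>F T ` space MX. \<P>((x, r) in S. g x = 1 \<and> F T x = v) > 0 \<longrightarrow>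
           \<bar>\<P>((x, r) in S. r \<le> F T x \<bar> g x = 1 \<and> F T x = v) - q\<bar>
             \<le> sqrt \<alpha> / sqrt (\<P>((x, r) in S. g x = 1 \<and> F T x = v)) \<and>
           \<bar>\<P>((x, y) in D. y \<in> prediction_set MY s (F T) x \<bar> g x = 1 \<and> F T x = v) - q\<bar>
             \<le> sqrt \<alpha> / sqrt (\<P>((x, r) in S. g x = 1 \<and> F T x = v)))"
    proof (intro exI[of _ T] conjI ballI impI)
      show "batch_mvp_returns_after MX \<alpha> q G S F T"
        using cal nocal by (simp add: batch_mvp_returns_after_def)
    qed (use bound[OF nocal] decrease[OF nocal] cal bias D_eq[OF FT] in simp_all)
  qed
qed

end
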